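(* Let $F:\mathbb{R}^d\to\mathbb{R}$ be continuously differentiable and bounded from below, with $\|\nabla F(x)-\nabla F(y)\|\le L\|x-y\|$ for all $x,y\in\mathbb{R}^d$, where $L>0$. Let the random vectors $(\theta_n,w_n,z_n,y_n)_{n\ge1}$ be generated from given initial data $(\theta_1,w_1)$ by the two-step accelerated gradient method $$z_n=(1-\tilde\gamma_n)\odot\theta_n+\tilde\gamma_n\odot w_n,\quad y_n=(1-\mu_n)\theta_n+\mu_n w_n,\quad w_{n+1}=w_n-\lambda_n\odot g_n,\quad \theta_{n+1}=y_n-\alpha_n\odot g_n\qquad(n\ge1),$$ where $\mu_1=1$ and $\mu_n\in(0,1)$ for $n\ge2$ are real numbers, $\tilde\gamma_n\in\mathbb{R}^d$ are (possibly random) positive vectors forming a bounded sequence with $\tilde\gamma_1=\mathbf 1$, and $\lambda_n,\alpha_n$ are (possibly random) positive stepsize vectors in $\mathbb{R}^d$. Let $B$ be a constant such that $\frac{\|1-\tilde\gamma_n\|^2}{1-\mu_n}\le B$ almost surely for all $n\ge2$. Write $\delta_n=g_n-\nabla F(z_n)$. Let $(\mathcal{F}_n)_{n\ge1}$ be an increasing sequence of $\sigma$-fields such that, for all $n\ge1$: $w_n,z_n,\lambda_n,\alpha_n$ are $\mathcal{F}_n$-measurable, $\mathbb{E}[g_n\mid\mathcal{F}_n]=\nabla F(z_n)$, and $\mathbb{E}[\|\delta_n\|^2\mid\mathcal{F}_n]\le\sigma^2$ almost surely, for some $\sigma>0$. Let $\Gamma_1=1$ and $\Gamma_n=(1-\mu_n)\Gamma_{n-1}$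 for $n\ge2$. Fix an integer $N\ge1$ and, for $1\le n\le N$, put $$C_{n,N}=\sum_{j=n}^{N}\Gamma_j,$$ $$Q_n=\Big\langle\delta_n,\ \lambda_n\odot\big(\nabla F(w_n)-L\lambda_n\odot\nabla F(z_n)\big)-LB\frac{C_{n,N}}{\mu_n\Gamma_n}[\lambda_n-\alpha_n]^2\odot\nabla F(z_n)\Big\rangle,$$ $$D_n=\lambda_n-L[\lambda_n]^2-\frac{LB}{2}\frac{C_{n,N}}{\mu_n\Gamma_n}[\lambda_n-\alpha_n]^2.$$ Assume that for every $1\le n\le N$ there is a real number $m_n>0$ such that $D_n\ge m_n$ componentwise, almost surely. Then, almost surely, $$F(w_{N+1})-F(w_1)+\sum_{n=1}^{N}m_n\|\nabla F(z_n)\|^2\le-\sum_{n=1}^{N}Q_n+\frac L2\sum_{n=1}^{N}\|\delta_n\|^2\Big(\|\lambda_n\|^2+B\frac{C_{n,N}}{\mu_n\Gamma_n}\|\lambda_n-\alpha_n\|^2\Big).$$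
   Context: All norms are Euclidean norms on $\mathbb{R}^d$ and $\langle\cdot,\cdot\rangle$ is the Euclidean inner product. $u\odot v$ is the componentwise (Hadamard) product, $[u]^2=u\odot u$; for a scalar $\rho$ and a vector $u$, expressions such as $\rho-u$ are taken componentwise, and $u\ge\rho$ means that every component of $u$ is $\ge\rho$. A vector is positive if all its components are positive; $\mathbf 1=(1,\dots,1)$. The random vector $g_n$ is a noisy (stochastic) evaluation of the gradient $\nabla F$ at the point $z_n$, and $\delta_n$ is its noise. *)

theory Defs
  imports "HOL-Probability.Probability"
begin

text \<open>
  Vectors of type \<open>real ^ 'd\<close> carry the library's componentwise ring structure: \<open>u * v\<close> is the
  Hadamard product, \<open>u\<^sup>2 = u * u\<close>, and \<open>1\<close> is the all-ones vector. The norm is Euclidean. The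
  library's strict order on vectors is not componentwise, hence the following predicate.
\<close>

definition positive_vec :: "real ^ 'd \<Rightarrow> bool" where
  "positive_vec u \<longleftrightarrow> (\<forall>i. 0 < u $ i)"

text \<open>
  The components are taken with \<open>real_cond_exp\<close>, the difference of the conditional expectations of
  positive and negative part, which also makes sense for non-integrable components whose positive
  and negative parts have a.s. finite conditional expectations.
\<close>

definition vec_cond_exp :: "'a measure \<Rightarrow> 'a measure \<Rightarrow> ('a \<Rightarrow> real ^ 'd) \<Rightarrow> 'a \<Rightarrow> real ^ 'd" where
  "vec_cond_exp M G X = (\<lambda>\<omega>. \<chi> i. real_cond_exp M G (\<lambda>\<omega>'. X \<omega>' $ i) \<omega>)"

text \<open>All sequences are indexed from 1; the value at 0 is junk.\<close>

fun Gam :: "(nat \<Rightarrow> real) \<Rightarrow> nat \<Rightarrow> real" where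
  "Gam \<mu> 0 = 1"
| "Gam \<mu> (Suc 0) = 1"
| "Gam \<mu> (Suc (Suc n)) = (1 - \<mu> (Suc (Suc n))) * Gam \<mu> (Suc n)"

definition C_sum :: "(nat \<Rightarrow> real) \<Rightarrow> nat \<Rightarrow> nat \<Rightarrow> real" where
  "C_sum \<mu> n N = (\<Sum>j = n..N. Gam \<mu> j)"

text \<open>
  \<open>Q_term\<close> and \<open>D_vec\<close> are pointwise in the sample: \<open>l, a, del, gw, gz\<close> stand for the values of
  \<open>\<lambda>\<^sub>n, \<alpha>\<^sub>n, \<delta>\<^sub>n, \<nabla>F(w\<^sub>n), \<nabla>F(z\<^sub>n)\<close>.
\<close>

definition Q_term ::
  "real \<Rightarrow> real \<Rightarrow> (nat \<Rightarrow> real) \<Rightarrow> nat \<Rightarrow> nat \<Rightarrow>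
   real ^ 'd \<Rightarrow> real ^ 'd \<Rightarrow> real ^ 'd \<Rightarrow> real ^ 'd \<Rightarrow> real ^ 'd \<Rightarrow> real" where
  "Q_term L B \<mu> N n l a del gw gz =
     del \<bullet> (l * (gw - L *\<^sub>R (l * gz))
            - (L * B * (C_sum \<mu> n N / (\<mu> n * Gam \<mu> n))) *\<^sub>R ((l - a)\<^sup>2 * gz))"

definition D_vec ::
  "real \<Rightarrow> real \<Rightarrow> (nat \<Rightarrow> real) \<Rightarrow> nat \<Rightarrow> nat \<Rightarrow> real ^ 'd \<Rightarrow> real ^ 'd \<Rightarrow> real ^ 'd" where
  "D_vec L B \<mu> N n l a =
     l - L *\<^sub>R l\<^sup>2 - (L * B / 2 * (C_sum \<mu> n N / (\<mu> n * Gam \<mu> n))) *\<^sub>R (l - a)\<^sup>2"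

end

theory Submission
  imports Defs
begin

text \<open>
  The inequality is deterministic: it holds along every sample path on which the recursions and
  the bounds hold, and countably many null sets are discarded in the end.

  Along a path write \<open>G = \<nabla>F(z\<^sub>n)\<close>, so that \<open>g\<^sub>n = G + \<delta>\<^sub>n\<close>. The quadratic upper bound for functions
  with an \<open>L\<close>-Lipschitz gradient (\<open>quadratic_upper_bound\<close>) is applied to the step from \<open>w\<^sub>n\<close> to
  \<open>w\<^sub>n\<^sub>+\<^sub>1\<close>. Replacing \<open>\<nabla>F(w\<^sub>n)\<close> by \<open>G\<close> in the first-order term costs, by the Lipschitz property
  and Young's inequality, at most \<open>L/2 (\<parallel>z\<^sub>n - w\<^sub>n\<parallel>\<^sup>2 + \<parallel>\<lambda>\<^sub>n \<odot> G\<parallel>\<^sup>2)\<close>. What remains is the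
  \<open>\<lambda>\<^sub>n\<close>-part of \<open>D\<^sub>n\<close>, of \<open>Q\<^sub>n\<close> and of the noise term, together with
  \<open>L/2 \<parallel>z\<^sub>n - w\<^sub>n\<parallel>\<^sup>2\<close> (\<open>one_step_descent\<close>).

  To bound the latter, note that \<open>z\<^sub>n - w\<^sub>n = (1 - \<gamma>\<^sub>n) \<odot> u\<^sub>n\<close>, where the gap \<open>u\<^sub>n = \<theta>\<^sub>n - w\<^sub>n\<close>
  obeys \<open>u\<^sub>n\<^sub>+\<^sub>1 = (1 - \<mu>\<^sub>n) u\<^sub>n + (\<lambda>\<^sub>n - \<alpha>\<^sub>n) \<odot> g\<^sub>n\<close>. Convexity of the squared norm turns this
  into a scalar recursion, which the weights \<open>\<Gamma>\<^sub>n\<close> solve (\<open>Gam_weighted_recursion\<close>); since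
  \<open>\<parallel>1 - \<gamma>\<^sub>n\<parallel>\<^sup>2 \<le> B (1 - \<mu>\<^sub>n)\<close>, the square \<open>\<parallel>z\<^sub>n - w\<^sub>n\<parallel>\<^sup>2\<close> is at most \<open>B \<Gamma>\<^sub>n\<close> times the sum of
  \<open>\<parallel>(\<lambda>\<^sub>k - \<alpha>\<^sub>k) \<odot> g\<^sub>k\<parallel>\<^sup>2 / (\<mu>\<^sub>k \<Gamma>\<^sub>k)\<close> over \<open>k < n\<close>. Summing over \<open>n\<close> and exchanging the order of
  summation produces the factors \<open>C\<^sub>k\<^sub>,\<^sub>N\<close> (\<open>sum_Gam_le_sum_C\<close>), and expanding the square of
  \<open>(\<lambda>\<^sub>k - \<alpha>\<^sub>k) \<odot> (G + \<delta>\<^sub>k)\<close> yields the \<open>(\<lambda>\<^sub>k - \<alpha>\<^sub>k)\<close>-parts of \<open>D\<^sub>k\<close> and \<open>Q\<^sub>k\<close> and, by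
  \<open>\<parallel>u \<odot> v\<parallel> \<le> \<parallel>u\<parallel> \<parallel>v\<parallel>\<close>, at most that of the noise term (\<open>two_step_method_descent\<close>).
\<close>

section \<open>Norms and inner products of componentwise products\<close>

lemma norm_mult_vec_le:
  fixes u v :: "real ^ 'd"
  shows "norm (u * v) \<le> norm u * norm v"
proof -
  have "norm (u * v) \<le> L2_set (\<lambda>i. norm u * norm (v $ i)) UNIV"
    unfolding norm_vec_def[of "u * v"]
  proof (rule L2_set_mono)
    fix i
    show "norm ((u * v) $ i) \<le> norm u * norm (v $ i)"
      using component_le_norm_cart[of u i] by (simp add: abs_mult mult_right_mono)
  qed simp
  also have "\<dots> = norm u * norm v"
    by (simp add: norm_vec_def L2_set_right_distrib)
  finally show ?thesis .
qed

lemma norm_mult_vec_power2_le: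
  fixes u v :: "real ^ 'd"
  shows "(norm (u * v))\<^sup>2 \<le> (norm u)\<^sup>2 * (norm v)\<^sup>2"
  by (metis norm_mult_vec_le norm_ge_zero power_mono power_mult_distrib)

lemma inner_mult_vec_ge:
  fixes d x :: "real ^ 'd"
  assumes "\<And>i. d $ i \<ge> c"
  shows "c * (norm x)\<^sup>2 \<le> (d * x) \<bullet> x"
proof -
  have "c * (norm x)\<^sup>2 = (\<Sum>i\<in>UNIV. c * (x $ i)\<^sup>2)"
    unfolding power2_norm_eq_inner inner_vec_def
    by (simp add: sum_distrib_left power2_eq_square)
  also have "\<dots> \<le> (\<Sum>i\<in>UNIV. d $ i * (x $ i)\<^sup>2)"
    by (intro sum_mono mult_right_mono assms) simp
  finally show ?thesis
    by (simp add: inner_vec_def power2_eq_square mult.assoc)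
qed

lemma norm_mult_vec_add_power2:
  fixes u v x :: "real ^ 'd"
  shows "(norm (u * (v + x)))\<^sup>2
    = ((u\<^sup>2 * v) \<bullet> v) + 2 * (x \<bullet> (u\<^sup>2 * v)) + (norm (u * x))\<^sup>2"
proof -
  have "(u * v) \<bullet> (u * v) = (u\<^sup>2 * v) \<bullet> v" "(u * v) \<bullet> (u * x) = x \<bullet> (u\<^sup>2 * v)"
    by (auto simp: inner_vec_def power2_eq_square mult_ac intro!: sum.cong)
  then show ?thesis
    by (simp add: power2_norm_eq_inner distrib_left inner_add_left inner_add_right inner_commute)
qed

text \<open>
  Convexity of the squared norm at the points \<open>u\<close> and \<open>v / \<mu>\<close>: the two sides differ by
  \<open>\<mu> (1 - \<mu>) \<parallel>u - v / \<mu>\<parallel>\<^sup>2\<close>.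
\<close>

lemma norm_power2_convex_step:
  fixes u v :: "'a :: real_inner"
  assumes "0 < \<mu>" "\<mu> \<le> 1"
  shows "(norm ((1 - \<mu>) *\<^sub>R u + v))\<^sup>2 \<le> (1 - \<mu>) * (norm u)\<^sup>2 + (norm v)\<^sup>2 / \<mu>"
proof -
  have "0 \<le> (1 - \<mu>) * (norm (\<mu> *\<^sub>R u - v))\<^sup>2 / \<mu>"
    using assms by simp
  also have "\<dots> = (1 - \<mu>) * (norm u)\<^sup>2 + (norm v)\<^sup>2 / \<mu> - (norm ((1 - \<mu>) *\<^sub>R u + v))\<^sup>2"
    using assms
    by (simp add: power2_norm_eq_inner inner_add_left inner_add_right inner_diff_left
        inner_diff_right inner_commute[of v u] field_simps)
  finally show ?thesis by simp
qed

section \<open>Functions with Lipschitz gradient\<close>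

text \<open>
  Along the segment from \<open>x\<close> to \<open>x + h\<close>, the difference of \<open>F\<close> and the quadratic model has derivative
  \<open>(\<nabla>F(x + t h) - \<nabla>F(x)) \<bullet> h - L t \<parallel>h\<parallel>\<^sup>2\<close>, which is nonpositive for
  \<open>t \<ge> 0\<close> by Cauchy--Schwarz and the Lipschitz property.
\<close>

lemma quadratic_upper_bound:
  fixes F :: "'a :: real_inner \<Rightarrow> real"
  assumes grad: "\<And>x. GDERIV F x :> gradF x"
    and Lip: "\<And>x x'. norm (gradF x - gradF x') \<le> L * norm (x - x')"
  shows "F (x + h) \<le> F x + gradF x \<bullet> h + L / 2 * (norm h)\<^sup>2"
proof -
  define \<phi> where "\<phi> t = F (x + t *\<^sub>R h) - t * (gradF x \<bullet> h) - L / 2 * t\<^sup>2 * (norm h)\<^sup>2" for t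
  have deriv: "(\<phi> has_real_derivative (gradF (x + t *\<^sub>R h) - gradF x) \<bullet> h - L * t * (norm h)\<^sup>2) (at t)"
    for t
  proof -
    have "((\<lambda>t. x + t *\<^sub>R h) has_derivative (\<lambda>s. s *\<^sub>R h)) (at t)"
      by (auto intro!: derivative_eq_intros)
    from has_derivative_compose[OF this grad[unfolded gderiv_def]]
    have F: "((\<lambda>t. F (x + t *\<^sub>R h)) has_real_derivative gradF (x + t *\<^sub>R h) \<bullet> h) (at t)"
      by (simp add: has_field_derivative_def inner_commute mult_commute_abs)
    show ?thesis
      unfolding \<phi>_def
      by (auto intro!: derivative_eq_intros F simp: inner_diff_left)
  qed
  have "\<phi> 1 \<le> \<phi> 0"
  proof (rule DERIV_nonpos_imp_nonincreasing[of 0 1 \<phi>])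
    fix t :: real
    assume t: "0 \<le> t" "t \<le> 1"
    have "(gradF (x + t *\<^sub>R h) - gradF x) \<bullet> h \<le> norm (gradF (x + t *\<^sub>R h) - gradF x) * norm h"
      by (rule norm_cauchy_schwarz)
    also have "\<dots> \<le> L * norm (x + t *\<^sub>R h - x) * norm h"
      by (intro mult_right_mono Lip) simp
    also have "\<dots> = L * t * (norm h)\<^sup>2"
      using t by (simp add: power2_eq_square)
    finally show "\<exists>y. DERIV \<phi> t :> y \<and> y \<le> 0"
      using deriv[of t] by fastforce
  qed simp
  then show ?thesis
    by (simp add: \<phi>_def)
qed

text \<open>
  A step in the direction of a perturbed gradient at \<open>z\<close> instead of at the current point \<open>w\<close>:
  the displacement \<open>z - w\<close> enters only through its square.
\<close>

lemma one_step_descent: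
  fixes F :: "real ^ 'd \<Rightarrow> real"
  assumes grad: "\<And>x. GDERIV F x :> gradF x"
    and Lip: "\<And>x x'. norm (gradF x - gradF x') \<le> L * norm (x - x')"
    and L: "0 \<le> L"
  shows "F (w - l * (gradF z + del)) \<le> F w - ((l - L *\<^sub>R l\<^sup>2) * gradF z) \<bullet> gradF z
    - del \<bullet> (l * (gradF w - L *\<^sub>R (l * gradF z)))
    + L / 2 * ((norm del)\<^sup>2 * (norm l)\<^sup>2) + L / 2 * (norm (z - w))\<^sup>2"
proof -
  define G where "G = gradF z"
  have "F (w - l * (G + del))
      \<le> F w - gradF w \<bullet> (l * (G + del)) + L / 2 * (norm (l * (G + del)))\<^sup>2"
    using quadratic_upper_bound[OF grad Lip, of w "- (l * (G + del))"] by simp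
  moreover have "gradF w \<bullet> (l * (G + del))
      = (l * G) \<bullet> G - (G - gradF w) \<bullet> (l * G) + del \<bullet> (l * gradF w)"
  proof -
    have "gradF w \<bullet> (l * del) = del \<bullet> (l * gradF w)"
      by (simp add: inner_vec_def mult_ac)
    then show ?thesis
      by (simp add: distrib_left inner_add_right inner_diff_left inner_commute[of "l * G" G])
  qed
  moreover have "L / 2 * (norm (l * (G + del)))\<^sup>2
      = L / 2 * ((l\<^sup>2 * G) \<bullet> G) + L * (del \<bullet> (l\<^sup>2 * G)) + L / 2 * (norm (l * del))\<^sup>2"
    unfolding norm_mult_vec_add_power2 by (simp add: algebra_simps)
  moreover have "(G - gradF w) \<bullet> (l * G) \<le> L / 2 * (norm (z - w))\<^sup>2 + L / 2 * ((l\<^sup>2 * G) \<bullet> G)"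
  proof -
    have "(G - gradF w) \<bullet> (l * G) \<le> norm (G - gradF w) * norm (l * G)"
      by (rule norm_cauchy_schwarz)
    also have "\<dots> \<le> L * norm (z - w) * norm (l * G)"
      unfolding G_def by (intro mult_right_mono Lip) simp
    also have "\<dots> \<le> L * (((norm (z - w))\<^sup>2 + (norm (l * G))\<^sup>2) / 2)"
      using mult_left_mono[OF sum_squares_bound[of "norm (z - w)" "norm (l * G)"] L]
      by (simp add: algebra_simps)
    also have "(norm (l * G))\<^sup>2 = (l\<^sup>2 * G) \<bullet> G"
      using norm_mult_vec_add_power2[of l G 0] by simp
    finally show ?thesis by (simp add: algebra_simps)
  qed
  moreover have "L / 2 * (norm (l * del))\<^sup>2 \<le> L / 2 * ((norm del)\<^sup>2 * (norm l)\<^sup>2)"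
    using L norm_mult_vec_power2_le[of l del] by (intro mult_left_mono) (auto simp: mult.commute)
  moreover have "((l - L *\<^sub>R l\<^sup>2) * G) \<bullet> G = (l * G) \<bullet> G - L * ((l\<^sup>2 * G) \<bullet> G)"
    by (simp add: left_diff_distrib inner_diff_left)
  moreover have "del \<bullet> (l * (gradF w - L *\<^sub>R (l * G))) = del \<bullet> (l * gradF w) - L * (del \<bullet> (l\<^sup>2 * G))"
    by (simp add: right_diff_distrib inner_diff_right power2_eq_square mult.assoc)
  ultimately show ?thesis
    unfolding G_def[symmetric] by linarith
qed

section \<open>The weights of the recursion\<close>

lemma Gam_rec: "2 \<le> n \<Longrightarrow> Gam \<mu> n = (1 - \<mu> n) * Gam \<mu> (n - 1)"
  by (cases "(\<mu>, n)" rule: Gam.cases) auto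

lemma Gam_pos:
  assumes "\<And>n. n \<ge> 2 \<Longrightarrow> \<mu> n < 1"
  shows "0 < Gam \<mu> n"
  using assms by (induction \<mu> n rule: Gam.induct) auto

text \<open>
  Dividing the recursion by \<open>\<Gamma>\<^sub>n\<close> makes it telescope. Since \<open>\<mu>\<^sub>1 = 1\<close>, the initial value is forgotten
  after one step.
\<close>

lemma Gam_weighted_recursion:
  assumes \<mu>_1: "\<mu> 1 = 1" and \<mu>_lt: "\<And>n. n \<ge> 2 \<Longrightarrow> \<mu> n < 1"
    and rec: "\<And>n. n \<ge> 1 \<Longrightarrow> a (Suc n) \<le> (1 - \<mu> n) * a n + v n / \<mu> n"
  shows "a (Suc (Suc n)) \<le> Gam \<mu> (Suc n) * (\<Sum>k = 1..Suc n. v k / (\<mu> k * Gam \<mu> k))"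
proof (induction n)
  case 0
  show ?case using rec[of 1] \<mu>_1 by simp
next
  case (Suc n)
  let ?S = "\<lambda>n. \<Sum>k = 1..n. v k / (\<mu> k * Gam \<mu> k)"
  define n' where "n' = Suc (Suc n)"
  have pos: "0 < Gam \<mu> n'" by (rule Gam_pos[OF \<mu>_lt])
  have lt: "\<mu> n' < 1" using \<mu>_lt[of n'] by (simp add: n'_def)
  have "a (Suc n') \<le> (1 - \<mu> n') * a n' + v n' / \<mu> n'"
    by (rule rec) (simp add: n'_def)
  also have "\<dots> \<le> (1 - \<mu> n') * (Gam \<mu> (Suc n) * ?S (Suc n)) + v n' / \<mu> n'"
    using Suc.IH lt unfolding n'_def by (intro add_right_mono mult_left_mono) auto
  also have "\<dots> = Gam \<mu> n' * ?S (Suc n) + v n' / \<mu> n'"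
    by (simp add: n'_def)
  also have "\<dots> = Gam \<mu> n' * (?S (Suc n) + v n' / (\<mu> n' * Gam \<mu> n'))"
    using pos by (simp add: distrib_left)
  also have "?S (Suc n) + v n' / (\<mu> n' * Gam \<mu> n') = ?S n'"
    by (simp add: n'_def)
  finally show ?case by (simp only: n'_def)
qed

text \<open>
  Exchanging the order of summation gives each \<open>b\<^sub>k\<close> the factor \<open>\<Gamma>\<^sub>k\<^sub>+\<^sub>1 + \<dots> + \<Gamma>\<^sub>N\<close>, which is
  \<open>C\<^sub>k\<^sub>,\<^sub>N - \<Gamma>\<^sub>k\<close>.
\<close>

lemma sum_Gam_le_sum_C:
  assumes \<mu>_lt: "\<And>n. n \<ge> 2 \<Longrightarrow> \<mu> n < 1" and b: "\<And>k. k \<ge> 1 \<Longrightarrow> 0 \<le> b k"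
  shows "(\<Sum>n = 1..N. Gam \<mu> n * (\<Sum>k = 1..<n. b k)) \<le> (\<Sum>k = 1..N. C_sum \<mu> k N * b k)"
proof (induction N)
  case 0
  show ?case by simp
next
  case (Suc N)
  have "(\<Sum>n = 1..Suc N. Gam \<mu> n * (\<Sum>k = 1..<n. b k))
      \<le> (\<Sum>k = 1..N. C_sum \<mu> k N * b k) + Gam \<mu> (Suc N) * (\<Sum>k = 1..N. b k)"
    using Suc.IH by (simp add: atLeastLessThanSuc_atLeastAtMost)
  also have "\<dots> = (\<Sum>k = 1..N. C_sum \<mu> k (Suc N) * b k)"
    by (simp add: C_sum_def sum_distrib_left flip: sum.distrib)
      (auto simp: distrib_right intro!: sum.cong)
  also have "\<dots> \<le> (\<Sum>k = 1..Suc N. C_sum \<mu> k (Suc N) * b k)"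
    using b[of "Suc N"] Gam_pos[OF \<mu>_lt] by (simp add: C_sum_def less_imp_le)
  finally show ?case .
qed

section \<open>The two-step method along a path\<close>

text \<open>
  The gap \<open>\<theta>\<^sub>n - w\<^sub>n\<close> contracts by \<open>1 - \<mu>\<^sub>n\<close> and is driven by the difference of the two stepsizes; at
  \<open>n = 1\<close> the points \<open>z\<^sub>1\<close> and \<open>w\<^sub>1\<close> agree, so the bound starts with an empty sum.
\<close>

lemma displacement_bound:
  fixes \<theta> w z y g \<gamma> lam \<alpha> :: "nat \<Rightarrow> real ^ 'd"
  assumes step_z: "\<And>n. n \<ge> 1 \<Longrightarrow> z n = (1 - \<gamma> n) * \<theta> n + \<gamma> n * w n"
    and step_y: "\<And>n. n \<ge> 1 \<Longrightarrow> y n = (1 - \<mu> n) *\<^sub>R \<theta> n + \<mu> n *\<^sub>R w n"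
    and step_w: "\<And>n. n \<ge> 1 \<Longrightarrow> w (Suc n) = w n - lam n * g n"
    and step_\<theta>: "\<And>n. n \<ge> 1 \<Longrightarrow> \<theta> (Suc n) = y n - \<alpha> n * g n"
    and \<mu>_1: "\<mu> 1 = 1"
    and \<mu>_range: "\<And>n. n \<ge> 2 \<Longrightarrow> \<mu> n \<in> {0<..<1}"
    and \<gamma>_1: "\<gamma> 1 = 1"
    and B_bound: "\<And>n. n \<ge> 2 \<Longrightarrow> (norm (1 - \<gamma> n))\<^sup>2 / (1 - \<mu> n) \<le> B"
    and n: "n \<ge> 1"
  shows "(norm (z n - w n))\<^sup>2
    \<le> B * (Gam \<mu> n * (\<Sum>k = 1..<n. (norm ((lam k - \<alpha> k) * g k))\<^sup>2 / (\<mu> k * Gam \<mu> k)))"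
proof -
  define u where "u n = \<theta> n - w n" for n
  have zw: "z n - w n = (1 - \<gamma> n) * u n"
    using step_z[OF n] by (simp add: u_def algebra_simps)
  have \<mu>_pos: "0 < \<mu> k \<and> \<mu> k \<le> 1" if "k \<ge> 1" for k
    using \<mu>_1 \<mu>_range[of k] that by (cases "k = 1") auto
  have gap: "u (Suc k) = (1 - \<mu> k) *\<^sub>R u k + (lam k - \<alpha> k) * g k" if "k \<ge> 1" for k
    by (simp add: u_def step_y[OF that] step_w[OF that] step_\<theta>[OF that] algebra_simps)
  have rec: "(norm (u (Suc k)))\<^sup>2
      \<le> (1 - \<mu> k) * (norm (u k))\<^sup>2 + (norm ((lam k - \<alpha> k) * g k))\<^sup>2 / \<mu> k" if "k \<ge> 1" for k
    unfolding gap[OF that] using \<mu>_pos[OF that] by (intro norm_power2_convex_step) auto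
  show ?thesis
  proof (cases "n = 1")
    case True
    then show ?thesis using zw \<gamma>_1 by simp
  next
    case False
    with n obtain k where k: "n = Suc (Suc k)"
      by (metis One_nat_def not0_implies_Suc not_one_le_zero)
    let ?S = "\<Sum>k = 1..<n. (norm ((lam k - \<alpha> k) * g k))\<^sup>2 / (\<mu> k * Gam \<mu> k)"
    have \<mu>n: "\<mu> n < 1" using \<mu>_range[of n] k by simp
    have bound: "(norm (1 - \<gamma> n))\<^sup>2 \<le> B * (1 - \<mu> n)"
      using B_bound[of n] k \<mu>n by (simp add: pos_divide_le_eq)
    have "0 \<le> (norm (1 - \<gamma> n))\<^sup>2 / (1 - \<mu> n)"
      using \<mu>n by simp
    also have "\<dots> \<le> B"
      using B_bound[of n] k by simp
    finally have B: "0 \<le> B" .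
    have "(norm (u n))\<^sup>2 \<le> Gam \<mu> (Suc k)
        * (\<Sum>k = 1..Suc k. (norm ((lam k - \<alpha> k) * g k))\<^sup>2 / (\<mu> k * Gam \<mu> k))"
      unfolding k using \<mu>_range rec
      by (intro Gam_weighted_recursion[where a = "\<lambda>n. (norm (u n))\<^sup>2"] \<mu>_1) auto
    then have un: "(norm (u n))\<^sup>2 \<le> Gam \<mu> (n - 1) * ?S"
      by (simp only: k atLeastLessThanSuc_atLeastAtMost diff_Suc_1)
    have "(norm (z n - w n))\<^sup>2 \<le> (norm (1 - \<gamma> n))\<^sup>2 * (norm (u n))\<^sup>2"
      unfolding zw by (rule norm_mult_vec_power2_le)
    also have "\<dots> \<le> (B * (1 - \<mu> n)) * (Gam \<mu> (n - 1) * ?S)"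
      using bound un B \<mu>n by (intro mult_mono) auto
    also have "\<dots> = B * (Gam \<mu> n * ?S)"
      using Gam_rec[of n \<mu>] k by (simp add: mult.assoc)
    finally show ?thesis .
  qed
qed

text \<open>
  Each displacement \<open>\<parallel>z\<^sub>n - w\<^sub>n\<parallel>\<^sup>2\<close> is charged to the earlier steps \<open>k < n\<close> that caused it. After
  summation, step \<open>k\<close> carries the charge \<open>L B / 2 \<cdot> C\<^sub>k\<^sub>,\<^sub>N / (\<mu>\<^sub>k \<Gamma>\<^sub>k) \<cdot> \<parallel>(\<lambda>\<^sub>k - \<alpha>\<^sub>k) \<odot> g\<^sub>k\<parallel>\<^sup>2\<close>, and the
  \<open>(\<lambda>\<^sub>k - \<alpha>\<^sub>k)\<close>-parts of \<open>D\<^sub>k\<close> and \<open>Q\<^sub>k\<close> are made to compensate it up to noise.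
\<close>

lemma two_step_method_descent:
  fixes F :: "real ^ 'd \<Rightarrow> real"
    and \<theta> w z y g \<gamma> lam \<alpha> :: "nat \<Rightarrow> real ^ 'd"
  assumes grad: "\<And>x. GDERIV F x :> gradF x"
    and L: "0 \<le> L"
    and Lip: "\<And>x x'. norm (gradF x - gradF x') \<le> L * norm (x - x')"
    and step_z: "\<And>n. n \<ge> 1 \<Longrightarrow> z n = (1 - \<gamma> n) * \<theta> n + \<gamma> n * w n"
    and step_y: "\<And>n. n \<ge> 1 \<Longrightarrow> y n = (1 - \<mu> n) *\<^sub>R \<theta> n + \<mu> n *\<^sub>R w n"
    and step_w: "\<And>n. n \<ge> 1 \<Longrightarrow> w (Suc n) = w n - lam n * g n"
    and step_\<theta>: "\<And>n. n \<ge> 1 \<Longrightarrow> \<theta> (Suc n) = y n - \<alpha> n * g n"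
    and \<mu>_1: "\<mu> 1 = 1"
    and \<mu>_range: "\<And>n. n \<ge> 2 \<Longrightarrow> \<mu> n \<in> {0<..<1}"
    and \<gamma>_1: "\<gamma> 1 = 1"
    and B_bound: "\<And>n. n \<ge> 2 \<Longrightarrow> (norm (1 - \<gamma> n))\<^sup>2 / (1 - \<mu> n) \<le> B"
    and \<delta>_eq: "\<And>n. n \<ge> 1 \<Longrightarrow> \<delta> n = g n - gradF (z n)"
    and D_ge: "\<And>n i. n \<in> {1..N} \<Longrightarrow> D_vec L B \<mu> N n (lam n) (\<alpha> n) $ i \<ge> m n"
  shows "F (w (N + 1)) - F (w 1) + (\<Sum>n = 1..N. m n * (norm (gradF (z n)))\<^sup>2)
    \<le> - (\<Sum>n = 1..N. Q_term L B \<mu> N n (lam n) (\<alpha> n) (\<delta> n) (gradF (w n)) (gradF (z n)))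
      + L / 2 * (\<Sum>n = 1..N. (norm (\<delta> n))\<^sup>2
          * ((norm (lam n))\<^sup>2 + B * (C_sum \<mu> n N / (\<mu> n * Gam \<mu> n)) * (norm (lam n - \<alpha> n))\<^sup>2))"
proof -
  define c where "c n = C_sum \<mu> n N / (\<mu> n * Gam \<mu> n)" for n
  define v where "v n = (norm ((lam n - \<alpha> n) * g n))\<^sup>2" for n
  define Q where "Q n = Q_term L B \<mu> N n (lam n) (\<alpha> n) (\<delta> n) (gradF (w n)) (gradF (z n))" for n
  define R where "R n = (norm (\<delta> n))\<^sup>2
      * ((norm (lam n))\<^sup>2 + B * c n * (norm (lam n - \<alpha> n))\<^sup>2)" for n
  have \<mu>_lt: "\<mu> n < 1" if "n \<ge> 2" for n
    using \<mu>_range[OF that] by simp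
  have \<mu>_pos: "0 < \<mu> n" if "n \<ge> 1" for n
    using \<mu>_1 \<mu>_range[of n] that by (cases "n = 1") auto
  have Gam: "0 < Gam \<mu> n" for n
    by (rule Gam_pos[OF \<mu>_lt])
  \<comment> \<open>The case \<open>N = 1\<close> is included here, as the bound by \<open>B\<close> holds at \<open>n = 2\<close> whatever \<open>N\<close> is.\<close>
  have "0 \<le> (norm (1 - \<gamma> 2))\<^sup>2 / (1 - \<mu> 2)"
    using \<mu>_lt[of 2] by simp
  also have "\<dots> \<le> B"
    by (rule B_bound) simp
  finally have B: "0 \<le> B" .
  have c: "0 \<le> c n" if "n \<ge> 1" for n
    unfolding c_def C_sum_def using \<mu>_pos[OF that] Gam by (simp add: sum_nonneg less_imp_le)

  \<comment> \<open>The term \<open>L / 2 * B * (c n * v n)\<close>, subtracted here, is charged to step \<open>n\<close> for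
    later displacements.\<close>
  have step: "F (w (Suc n)) - F (w n) + m n * (norm (gradF (z n)))\<^sup>2
      \<le> - Q n + L / 2 * R n - L / 2 * B * (c n * v n) + L / 2 * (norm (z n - w n))\<^sup>2"
    if n: "n \<in> {1..N}" for n
  proof -
    define G where "G = gradF (z n)"
    define s where "s = lam n - \<alpha> n"
    have g: "g n = G + \<delta> n"
      using \<delta>_eq n by (simp add: G_def)
    define K where "K = L / 2 * B * c n"
    have K: "0 \<le> K"
      using L B c n by (simp add: K_def)
    have "F (w (Suc n)) \<le> F (w n) - ((lam n - L *\<^sub>R (lam n)\<^sup>2) * G) \<bullet> G
        - \<delta> n \<bullet> (lam n * (gradF (w n) - L *\<^sub>R (lam n * G)))
        + L / 2 * ((norm (\<delta> n))\<^sup>2 * (norm (lam n))\<^sup>2) + L / 2 * (norm (z n - w n))\<^sup>2"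
      using one_step_descent[OF grad Lip L, of "w n" "lam n" "z n" "\<delta> n"] step_w n g
      by (simp add: G_def)
    moreover have "m n * (norm G)\<^sup>2 \<le> (D_vec L B \<mu> N n (lam n) (\<alpha> n) * G) \<bullet> G"
      by (rule inner_mult_vec_ge) (rule D_ge[OF n])
    moreover have "(D_vec L B \<mu> N n (lam n) (\<alpha> n) * G) \<bullet> G
        = ((lam n - L *\<^sub>R (lam n)\<^sup>2) * G) \<bullet> G - K * ((s\<^sup>2 * G) \<bullet> G)"
      by (simp add: K_def D_vec_def c_def s_def left_diff_distrib inner_diff_left)
    moreover have "Q n = \<delta> n \<bullet> (lam n * (gradF (w n) - L *\<^sub>R (lam n * G)))
        - 2 * (K * (\<delta> n \<bullet> (s\<^sup>2 * G)))"
      by (simp add: K_def Q_def Q_term_def c_def s_def G_def inner_diff_right)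
    moreover have "K * v n
        \<le> K * ((s\<^sup>2 * G) \<bullet> G) + 2 * (K * (\<delta> n \<bullet> (s\<^sup>2 * G)))
          + K * ((norm s)\<^sup>2 * (norm (\<delta> n))\<^sup>2)"
      using mult_left_mono[OF norm_mult_vec_power2_le[of s "\<delta> n"] K]
      unfolding v_def g s_def[symmetric] norm_mult_vec_add_power2 by (simp add: distrib_left)
    moreover have "L / 2 * B * (c n * v n) = K * v n"
      by (simp add: K_def)
    moreover have "L / 2 * R n = L / 2 * ((norm (\<delta> n))\<^sup>2 * (norm (lam n))\<^sup>2)
        + K * ((norm s)\<^sup>2 * (norm (\<delta> n))\<^sup>2)"
      by (simp add: K_def R_def s_def algebra_simps)
    ultimately show ?thesis
      unfolding G_def[symmetric] by linarith
  qed

  have "(\<Sum>n = 1..N. (norm (z n - w n))\<^sup>2)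
      \<le> (\<Sum>n = 1..N. B * (Gam \<mu> n * (\<Sum>k = 1..<n. v k / (\<mu> k * Gam \<mu> k))))"
    unfolding v_def
    by (intro sum_mono displacement_bound[OF step_z step_y step_w step_\<theta> \<mu>_1 \<mu>_range \<gamma>_1 B_bound])
      auto
  also have "\<dots> = B * (\<Sum>n = 1..N. Gam \<mu> n * (\<Sum>k = 1..<n. v k / (\<mu> k * Gam \<mu> k)))"
    by (rule sum_distrib_left[symmetric])
  also have "\<dots> \<le> B * (\<Sum>k = 1..N. C_sum \<mu> k N * (v k / (\<mu> k * Gam \<mu> k)))"
    using Gam \<mu>_pos by (intro mult_left_mono[OF _ B] sum_Gam_le_sum_C \<mu>_lt) (auto simp: v_def less_imp_le)
  also have "(\<Sum>k = 1..N. C_sum \<mu> k N * (v k / (\<mu> k * Gam \<mu> k))) = (\<Sum>k = 1..N. c k * v k)"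
    by (simp add: c_def)
  finally have "(\<Sum>n = 1..N. (norm (z n - w n))\<^sup>2) \<le> B * (\<Sum>k = 1..N. c k * v k)" .
  then have disp: "L / 2 * (\<Sum>n = 1..N. (norm (z n - w n))\<^sup>2) \<le> L / 2 * B * (\<Sum>k = 1..N. c k * v k)"
    using L by (simp add: mult_left_mono mult.assoc)

  have "F (w (N + 1)) - F (w 1) + (\<Sum>n = 1..N. m n * (norm (gradF (z n)))\<^sup>2)
      = (\<Sum>n = 1..N. F (w (Suc n)) - F (w n) + m n * (norm (gradF (z n)))\<^sup>2)"
    using sum_Suc_diff[of 1 N "\<lambda>n. F (w n)"] by (simp add: sum.distrib)
  also have "\<dots> \<le> (\<Sum>n = 1..N. - Q n + L / 2 * R n - L / 2 * B * (c n * v n)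
      + L / 2 * (norm (z n - w n))\<^sup>2)"
    by (rule sum_mono) (rule step)
  also have "\<dots> = - (\<Sum>n = 1..N. Q n) + L / 2 * (\<Sum>n = 1..N. R n)
      - L / 2 * B * (\<Sum>n = 1..N. c n * v n) + L / 2 * (\<Sum>n = 1..N. (norm (z n - w n))\<^sup>2)"
    by (simp only: sum.distrib sum_subtractf sum_negf sum_distrib_left)
  also have "\<dots> \<le> - (\<Sum>n = 1..N. Q n) + L / 2 * (\<Sum>n = 1..N. R n)"
    using disp by simp
  finally show ?thesis
    unfolding Q_def R_def c_def .
qed

section \<open>The almost sure descent inequality\<close>

theorem lemma4:
  fixes F :: "real ^ 'd \<Rightarrow> real"
    and gradF :: "real ^ 'd \<Rightarrow> real ^ 'd"
    and L B \<sigma> :: real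
    and M :: "'a measure"
    and \<F> :: "nat \<Rightarrow> 'a measure"
    and \<theta> w z y g \<delta> \<gamma> lam \<alpha> :: "nat \<Rightarrow> 'a \<Rightarrow> real ^ 'd"
    and \<mu> m :: "nat \<Rightarrow> real"
    and N :: nat
  assumes grad: "\<And>x. GDERIV F x :> gradF x"
    and grad_cont: "continuous_on UNIV gradF"
    and bdd: "bdd_below (range F)"
    and L_pos: "L > 0"
    and Lip: "\<And>x x'. norm (gradF x - gradF x') \<le> L * norm (x - x')"
    and prob: "prob_space M"
    and meas: "\<And>n. n \<ge> 1 \<Longrightarrow> \<theta> n \<in> borel_measurable M"
              "\<And>n. n \<ge> 1 \<Longrightarrow> y n \<in> borel_measurable M"
              "\<And>n. n \<ge> 1 \<Longrightarrow> g n \<in> borel_measurable M"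
              "\<And>n. n \<ge> 1 \<Longrightarrow> \<gamma> n \<in> borel_measurable M"
    and step_z: "\<And>n. n \<ge> 1 \<Longrightarrow> AE \<omega> in M. z n \<omega> = (1 - \<gamma> n \<omega>) * \<theta> n \<omega> + \<gamma> n \<omega> * w n \<omega>"
    and step_y: "\<And>n. n \<ge> 1 \<Longrightarrow> AE \<omega> in M. y n \<omega> = (1 - \<mu> n) *\<^sub>R \<theta> n \<omega> + \<mu> n *\<^sub>R w n \<omega>"
    and step_w: "\<And>n. n \<ge> 1 \<Longrightarrow> AE \<omega> in M. w (Suc n) \<omega> = w n \<omega> - lam n \<omega> * g n \<omega>"
    and step_\<theta>: "\<And>n. n \<ge> 1 \<Longrightarrow> AE \<omega> in M. \<theta> (Suc n) \<omega> = y n \<omega> - \<alpha> n \<omega> * g n \<omega>"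
    and \<mu>_1: "\<mu> 1 = 1"
    and \<mu>_range: "\<And>n. n \<ge> 2 \<Longrightarrow> \<mu> n \<in> {0<..<1}"
    and \<gamma>_pos: "\<And>n. n \<ge> 1 \<Longrightarrow> AE \<omega> in M. positive_vec (\<gamma> n \<omega>)"
    and \<gamma>_bounded: "AE \<omega> in M. bounded ((\<lambda>n. \<gamma> n \<omega>) ` {1..})"
    and \<gamma>_1: "AE \<omega> in M. \<gamma> 1 \<omega> = 1"
    and lam_pos: "\<And>n. n \<ge> 1 \<Longrightarrow> AE \<omega> in M. positive_vec (lam n \<omega>)"
    and \<alpha>_pos: "\<And>n. n \<ge> 1 \<Longrightarrow> AE \<omega> in M. positive_vec (\<alpha> n \<omega>)"
    and B_bound: "\<And>n. n \<ge> 2 \<Longrightarrow> AE \<omega> in M. (norm (1 - \<gamma> n \<omega>))\<^sup>2 / (1 - \<mu> n) \<le> B"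
    and \<delta>_eq: "\<And>n \<omega>. n \<ge> 1 \<Longrightarrow> \<delta> n \<omega> = g n \<omega> - gradF (z n \<omega>)"
    and subalg: "\<And>n. n \<ge> 1 \<Longrightarrow> subalgebra M (\<F> n)"
    and \<F>_mono: "\<And>i j. 1 \<le> i \<Longrightarrow> i \<le> j \<Longrightarrow> sets (\<F> i) \<subseteq> sets (\<F> j)"
    and adapted: "\<And>n. n \<ge> 1 \<Longrightarrow> w n \<in> borel_measurable (\<F> n)"
                 "\<And>n. n \<ge> 1 \<Longrightarrow> z n \<in> borel_measurable (\<F> n)"
                 "\<And>n. n \<ge> 1 \<Longrightarrow> lam n \<in> borel_measurable (\<F> n)"
                 "\<And>n. n \<ge> 1 \<Longrightarrow> \<alpha> n \<in> borel_measurable (\<F> n)"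
    and unbiased: "\<And>n. n \<ge> 1 \<Longrightarrow> AE \<omega> in M. vec_cond_exp M (\<F> n) (g n) \<omega> = gradF (z n \<omega>)"
    and \<sigma>_pos: "\<sigma> > 0"
    and variance: "\<And>n. n \<ge> 1 \<Longrightarrow>
        AE \<omega> in M. nn_cond_exp M (\<F> n) (\<lambda>\<omega>'. ennreal ((norm (\<delta> n \<omega>'))\<^sup>2)) \<omega> \<le> ennreal (\<sigma>\<^sup>2)"
    and N: "N \<ge> 1"
    and m_pos: "\<And>n. n \<in> {1..N} \<Longrightarrow> m n > 0"
    and D_ge: "\<And>n. n \<in> {1..N} \<Longrightarrow>
        AE \<omega> in M. \<forall>i. D_vec L B \<mu> N n (lam n \<omega>) (\<alpha> n \<omega>) $ i \<ge> m n"
  shows "AE \<omega> in M.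
      F (w (N + 1) \<omega>) - F (w 1 \<omega>) + (\<Sum>n = 1..N. m n * (norm (gradF (z n \<omega>)))\<^sup>2)
      \<le> - (\<Sum>n = 1..N.
             Q_term L B \<mu> N n (lam n \<omega>) (\<alpha> n \<omega>) (\<delta> n \<omega>) (gradF (w n \<omega>)) (gradF (z n \<omega>)))
         + L / 2 * (\<Sum>n = 1..N. (norm (\<delta> n \<omega>))\<^sup>2
             * ((norm (lam n \<omega>))\<^sup>2
                + B * (C_sum \<mu> n N / (\<mu> n * Gam \<mu> n)) * (norm (lam n \<omega> - \<alpha> n \<omega>))\<^sup>2))"
proof -
  have "AE \<omega> in M. \<forall>n\<in>{1..}. z n \<omega> = (1 - \<gamma> n \<omega>) * \<theta> n \<omega> + \<gamma> n \<omega> * w n \<omega>"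
    by (rule AE_ball_countable') (use step_z in simp_all)
  moreover have "AE \<omega> in M. \<forall>n\<in>{1..}. y n \<omega> = (1 - \<mu> n) *\<^sub>R \<theta> n \<omega> + \<mu> n *\<^sub>R w n \<omega>"
    by (rule AE_ball_countable') (use step_y in simp_all)
  moreover have "AE \<omega> in M. \<forall>n\<in>{1..}. w (Suc n) \<omega> = w n \<omega> - lam n \<omega> * g n \<omega>"
    by (rule AE_ball_countable') (use step_w in simp_all)
  moreover have "AE \<omega> in M. \<forall>n\<in>{1..}. \<theta> (Suc n) \<omega> = y n \<omega> - \<alpha> n \<omega> * g n \<omega>"
    by (rule AE_ball_countable') (use step_\<theta> in simp_all)
  moreover have "AE \<omega> in M. \<forall>n\<in>{2..}. (norm (1 - \<gamma> n \<omega>))\<^sup>2 / (1 - \<mu> n) \<le> B"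
    by (rule AE_ball_countable') (use B_bound in simp_all)
  moreover have "AE \<omega> in M. \<forall>n\<in>{1..N}. \<forall>i. D_vec L B \<mu> N n (lam n \<omega>) (\<alpha> n \<omega>) $ i \<ge> m n"
    by (rule AE_ball_countable') (use D_ge in simp_all)
  ultimately show ?thesis
    using \<gamma>_1
  proof eventually_elim
    case (elim \<omega>)
    show ?case
    proof (rule two_step_method_descent[where F = F and gradF = gradF and \<theta> = "\<lambda>n. \<theta> n \<omega>"
          and y = "\<lambda>n. y n \<omega>" and g = "\<lambda>n. g n \<omega>" and \<gamma> = "\<lambda>n. \<gamma> n \<omega>"])
      show "GDERIV F x :> gradF x" for x
        by (rule grad)
      show "norm (gradF x - gradF x') \<le> L * norm (x - x')" for x x'
        by (rule Lip)
      show "0 \<le> L" "\<mu> 1 = 1" "\<gamma> 1 \<omega> = 1"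
        using L_pos \<mu>_1 elim(7) by simp_all
      show "\<mu> n \<in> {0<..<1}" if "n \<ge> 2" for n
        using \<mu>_range that .
      show "\<delta> n \<omega> = g n \<omega> - gradF (z n \<omega>)" if "n \<ge> 1" for n
        using \<delta>_eq that .
    qed (use elim(1-6) in \<open>simp_all only: Ball_def atLeast_iff\<close>)
  qed
qed

end
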